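(* Let $G=(V,E)$ be a finite undirected graph with symmetric edge weights $w_{ij}=w_{ji}\ge 0$, in which each node $i\in V$ has internal opinion $s_i\in[0,1]$, and let $\mathbf{z}=(z_i)_{i\in V}$ be the vector of equilibrium expressed opinions (with no expressed opinion fixed). Then, independently of the structure of the graph (the set of edges $E$), $$g(\mathbf{z})=\sum_{i\in V}z_i=\sum_{i\in V}s_i .$$
   Context: Write $N(i)=\{j:(i,j)\in E\}$. The equilibrium vector of expressed opinions $\mathbf{z}=(z_i)_{i\in V}$ is the unique vector satisfying $$z_i=\frac{s_i+\sum_{j\in N(i)}w_{ij}z_j}{1+\sum_{j\in N(i)}w_{ij}}\qquad\text{for all } i\in V,$$ i.e. the Nash equilibrium of the game in which each node $i$ chooses $z_i$ to minimize its cost $(s_i-z_i)^2+\sum_{j\in N(i)}w_{ij}(z_i-z_j)^2$. The overall opinion is $g(\mathbf{z})=\sum_{i\in V}z_i$. *)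

theory Defs
  imports "HOL-Analysis.Analysis"
begin

text \<open>
  An undirected graph is a finite vertex set \<open>V\<close> together with a symmetric relation \<open>E \<subseteq> V \<times> V\<close>;
  an undirected edge is the pair of its two orientations. Self-loops are not excluded.
\<close>

definition undirected_graph :: "'v set \<Rightarrow> ('v \<times> 'v) set \<Rightarrow> bool" where
  "undirected_graph V E \<longleftrightarrow> finite V \<and> E \<subseteq> V \<times> V \<and> sym E"

definition neighbours :: "('v \<times> 'v) set \<Rightarrow> 'v \<Rightarrow> 'v set" where
  "neighbours E i = {j. (i, j) \<in> E}"

definition equilibrium_opinions ::
    "'v set \<Rightarrow> ('v \<times> 'v) set \<Rightarrow> ('v \<Rightarrow> 'v \<Rightarrow> real) \<Rightarrow> ('v \<Rightarrow> real) \<Rightarrow> ('v \<Rightarrow> real) \<Rightarrow> bool" where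
  "equilibrium_opinions V E w s z \<longleftrightarrow>
     (\<forall>i\<in>V. z i = (s i + (\<Sum>j\<in>neighbours E i. w i j * z j)) / (1 + (\<Sum>j\<in>neighbours E i. w i j)))"

definition overall_opinion :: "'v set \<Rightarrow> ('v \<Rightarrow> real) \<Rightarrow> real" where
  "overall_opinion V z = (\<Sum>i\<in>V. z i)"

text \<open>
  The equations in \<open>equilibrium_opinions\<close> characterise the Nash equilibrium of the opinion game,
  and they have exactly one solution on \<open>V\<close>.
\<close>

definition opinion_cost ::
    "('v \<times> 'v) set \<Rightarrow> ('v \<Rightarrow> 'v \<Rightarrow> real) \<Rightarrow> ('v \<Rightarrow> real) \<Rightarrow> ('v \<Rightarrow> real) \<Rightarrow> 'v \<Rightarrow> real" where
  "opinion_cost E w s z i = (s i - z i)\<^sup>2 + (\<Sum>j\<in>neighbours E i. w i j * (z i - z j)\<^sup>2)"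

definition nash_equilibrium ::
    "'v set \<Rightarrow> ('v \<times> 'v) set \<Rightarrow> ('v \<Rightarrow> 'v \<Rightarrow> real) \<Rightarrow> ('v \<Rightarrow> real) \<Rightarrow> ('v \<Rightarrow> real) \<Rightarrow> bool" where
  "nash_equilibrium V E w s z \<longleftrightarrow>
     (\<forall>i\<in>V. \<forall>x. opinion_cost E w s z i \<le> opinion_cost E w s (z(i := x)) i)"

lemma finite_neighbours: "undirected_graph V E \<Longrightarrow> finite (neighbours E i)"
  unfolding undirected_graph_def neighbours_def
  by (rule finite_subset[of _ V]) auto

lemma neighbours_subset: "undirected_graph V E \<Longrightarrow> neighbours E i \<subseteq> V"
  unfolding undirected_graph_def neighbours_def by auto

lemma opinion_cost_deviation:
  assumes fin: "finite (neighbours E i)"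
  shows "opinion_cost E w s (z(i := x)) i - opinion_cost E w s z i =
    (1 + (\<Sum>j\<in>neighbours E i - {i}. w i j)) * (x - z i)\<^sup>2 +
    2 * (x - z i) * ((z i - s i) + (\<Sum>j\<in>neighbours E i. w i j * (z i - z j)))"
proof -
  let ?N = "neighbours E i"
  have rest: "(\<Sum>j\<in>?N. f j) = (\<Sum>j\<in>?N - {i}. f j)" if "f i = 0" for f :: "'a \<Rightarrow> real"
    using that by (intro sum.mono_neutral_right fin) auto
  have 1: "(\<Sum>j\<in>?N. w i j * ((z(i := x)) i - (z(i := x)) j)\<^sup>2) = (\<Sum>j\<in>?N - {i}. w i j * (x - z j)\<^sup>2)"
    by (subst rest) (auto intro!: sum.cong)
  have 2: "(\<Sum>j\<in>?N. w i j * (z i - z j)\<^sup>2) = (\<Sum>j\<in>?N - {i}. w i j * (z i - z j)\<^sup>2)"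
    by (rule rest) simp
  have 3: "(\<Sum>j\<in>?N. w i j * (z i - z j)) = (\<Sum>j\<in>?N - {i}. w i j * (z i - z j))"
    by (rule rest) simp
  have 4: "(\<Sum>j\<in>?N - {i}. w i j * (x - z j)\<^sup>2) - (\<Sum>j\<in>?N - {i}. w i j * (z i - z j)\<^sup>2) =
      (\<Sum>j\<in>?N - {i}. w i j) * (x - z i)\<^sup>2 + 2 * (x - z i) * (\<Sum>j\<in>?N - {i}. w i j * (z i - z j))"
    unfolding sum_subtractf[symmetric] sum_distrib_left sum_distrib_right sum.distrib[symmetric]
    by (intro sum.cong refl) (simp add: power2_eq_square algebra_simps)
  have 5: "(s i - x)\<^sup>2 - (s i - z i)\<^sup>2 = (x - z i)\<^sup>2 + 2 * (x - z i) * (z i - s i)"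
    by (simp add: power2_eq_square algebra_simps)
  show ?thesis
    unfolding opinion_cost_def 1 2 3 using 4 5 by (simp add: distrib_left distrib_right)
qed

lemma nash_equilibrium_iff_equilibrium_opinions:
  assumes G: "undirected_graph V E"
    and w: "\<And>i j. (i, j) \<in> E \<Longrightarrow> w i j \<ge> 0"
  shows "nash_equilibrium V E w s z \<longleftrightarrow> equilibrium_opinions V E w s z"
  unfolding nash_equilibrium_def equilibrium_opinions_def
proof (rule ball_cong[OF refl])
  fix i
  let ?N = "neighbours E i"
  define D where "D = (z i - s i) + (\<Sum>j\<in>?N. w i j * (z i - z j))"
  define A where "A = 1 + (\<Sum>j\<in>?N - {i}. w i j)"
  have A: "A > 0"
    unfolding A_def by (intro add_pos_nonneg sum_nonneg) (auto simp: neighbours_def w)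
  have W: "1 + (\<Sum>j\<in>?N. w i j) > 0"
    by (intro add_pos_nonneg sum_nonneg) (auto simp: neighbours_def w)
  have dev: "opinion_cost E w s (z(i := x)) i - opinion_cost E w s z i
      = A * (x - z i)\<^sup>2 + 2 * (x - z i) * D" for x
    unfolding A_def D_def by (rule opinion_cost_deviation[OF finite_neighbours[OF G]])
  have "(\<forall>x. opinion_cost E w s z i \<le> opinion_cost E w s (z(i := x)) i) \<longleftrightarrow> D = 0"
  proof
    assume "\<forall>x. opinion_cost E w s z i \<le> opinion_cost E w s (z(i := x)) i"
    then have "0 \<le> A * ((z i - D / A) - z i)\<^sup>2 + 2 * ((z i - D / A) - z i) * D"
      using dev[of "z i - D / A"] by (metis diff_ge_0_iff_ge)
    also have "\<dots> = - (D\<^sup>2 / A)"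
      using A by (simp add: power2_eq_square field_simps)
    finally have "D\<^sup>2 / A \<le> 0" by simp
    then show "D = 0"
      using A by (simp add: divide_le_0_iff)
  next
    assume "D = 0"
    then have "opinion_cost E w s (z(i := x)) i - opinion_cost E w s z i \<ge> 0" for x
      unfolding dev using A by simp
    then show "\<forall>x. opinion_cost E w s z i \<le> opinion_cost E w s (z(i := x)) i"
      by simp
  qed
  also have "D = z i * (1 + (\<Sum>j\<in>?N. w i j)) - (s i + (\<Sum>j\<in>?N. w i j * z j))"
    unfolding D_def right_diff_distrib sum_subtractf sum_distrib_left distrib_left
    by (simp add: mult.commute)
  then have "D = 0 \<longleftrightarrow> z i = (s i + (\<Sum>j\<in>?N. w i j * z j)) / (1 + (\<Sum>j\<in>?N. w i j))"
    using W by (simp add: eq_divide_eq)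
  finally show "(\<forall>x. opinion_cost E w s z i \<le> opinion_cost E w s (z(i := x)) i) \<longleftrightarrow>
      z i = (s i + (\<Sum>j\<in>?N. w i j * z j)) / (1 + (\<Sum>j\<in>?N. w i j))" .
qed

lemma equilibrium_opinions_unique:
  assumes G: "undirected_graph V E"
    and w: "\<And>i j. (i, j) \<in> E \<Longrightarrow> w i j \<ge> 0"
    and y: "equilibrium_opinions V E w s y" and z: "equilibrium_opinions V E w s z"
    and k: "k \<in> V"
  shows "y k = z k"
proof -
  let ?d = "\<lambda>i. \<bar>y i - z i\<bar>"
  have finV: "finite V" using G by (simp add: undirected_graph_def)
  obtain m where m: "m \<in> V" and max: "\<And>i. i \<in> V \<Longrightarrow> ?d i \<le> ?d m"
  proof -
    have "Max (?d ` V) \<in> ?d ` V" using finV k by (intro Max_in) auto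
    then obtain m where "m \<in> V" "Max (?d ` V) = ?d m" by auto
    moreover have "?d i \<le> Max (?d ` V)" if "i \<in> V" for i using finV that by (intro Max_ge) auto
    ultimately show thesis by (intro that[of m]) auto
  qed
  let ?N = "neighbours E m"
  have wm: "w m j \<ge> 0" if "j \<in> ?N" for j using that w by (simp add: neighbours_def)
  define W where "W = (\<Sum>j\<in>?N. w m j)"
  have W: "W \<ge> 0" unfolding W_def by (intro sum_nonneg wm)
  have "y m * (1 + W) = s m + (\<Sum>j\<in>?N. w m j * y j)" "z m * (1 + W) = s m + (\<Sum>j\<in>?N. w m j * z j)"
    using y z m W unfolding equilibrium_opinions_def W_def by (simp_all add: eq_divide_eq)
  then have "(y m - z m) * (1 + W) = (\<Sum>j\<in>?N. w m j * (y j - z j))"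
    by (simp add: left_diff_distrib right_diff_distrib sum_subtractf)
  then have "?d m * (1 + W) = \<bar>\<Sum>j\<in>?N. w m j * (y j - z j)\<bar>"
    using W by (metis abs_mult abs_of_nonneg add_nonneg_nonneg zero_le_one)
  also have "\<dots> \<le> (\<Sum>j\<in>?N. \<bar>w m j * (y j - z j)\<bar>)" by (rule sum_abs)
  also have "\<dots> \<le> (\<Sum>j\<in>?N. w m j * ?d m)"
    using wm max neighbours_subset[OF G, of m]
    by (intro sum_mono) (auto simp: abs_mult intro!: mult_left_mono)
  also have "\<dots> = ?d m * W" unfolding W_def by (simp add: sum_distrib_right[symmetric] mult.commute)
  finally have "?d m \<le> 0" by (simp add: distrib_left)
  then show ?thesis using max[OF k] by simp
qed

lemma equilibrium_opinions_exists:
  assumes G: "undirected_graph V E"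
    and w: "\<And>i j. (i, j) \<in> E \<Longrightarrow> w i j \<ge> 0"
    and s: "\<And>i. i \<in> V \<Longrightarrow> s i \<in> {0..1}"
  shows "\<exists>z. equilibrium_opinions V E w s z"
proof -
  let ?N = "neighbours E"
  define T where "T = (\<lambda>z i. if i \<in> V then
    (s i + (\<Sum>j\<in>?N i. w i j * z j)) / (1 + (\<Sum>j\<in>?N i. w i j)) else (0::real))"
  define u where "u = (\<lambda>n. (T ^^ n) (\<lambda>_. 0))"
  have u_Suc: "u (Suc n) = T (u n)" for n by (simp add: u_def)
  have wi: "w i j \<ge> 0" if "j \<in> ?N i" for i j using that w by (simp add: neighbours_def)
  have W: "1 + (\<Sum>j\<in>?N i. w i j) > 0" for i by (intro add_pos_nonneg sum_nonneg wi) auto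
  have bounds: "0 \<le> u n i \<and> u n i \<le> 1" for n i
  proof (induction n arbitrary: i)
    case 0
    then show ?case by (simp add: u_def)
  next
    case (Suc n)
    have "0 \<le> (\<Sum>j\<in>?N i. w i j * u n j)" using Suc wi by (intro sum_nonneg) auto
    moreover have "(\<Sum>j\<in>?N i. w i j * u n j) \<le> (\<Sum>j\<in>?N i. w i j)"
      using Suc wi by (intro sum_mono mult_left_le) auto
    ultimately show ?case
      using s[of i] W[of i] by (auto simp: u_Suc T_def intro!: divide_nonneg_pos)
  qed
  have mono: "u n i \<le> u (Suc n) i" for n i
  proof (induction n arbitrary: i)
    case 0
    then show ?case using bounds[of "Suc 0" i] by (simp add: u_def)
  next
    case (Suc n)
    have "(\<Sum>j\<in>?N i. w i j * u n j) \<le> (\<Sum>j\<in>?N i. w i j * u (Suc n) j)"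
      using Suc wi by (intro sum_mono mult_left_mono) auto
    then show ?case
      using W[of i] u_Suc[of n] u_Suc[of "Suc n"]
      by (auto simp: T_def intro!: divide_right_mono)
  qed
  have "convergent (\<lambda>n. u n i)" for i
  proof (rule Bseq_mono_convergent)
    show "Bseq (\<lambda>n. u n i)"
      by (rule BseqI'[of _ 1]) (use bounds in simp)
    show "\<forall>m n. m \<le> n \<longrightarrow> u m i \<le> u n i"
      using lift_Suc_mono_le[of "\<lambda>n. u n i", OF mono] by blast
  qed
  then obtain z where z: "\<And>i. (\<lambda>n. u n i) \<longlonglongrightarrow> z i" unfolding convergent_def by metis
  have "equilibrium_opinions V E w s z"
    unfolding equilibrium_opinions_def
  proof
    fix i assume i: "i \<in> V"
    have "(\<lambda>n. u (Suc n) i) \<longlonglongrightarrow> (s i + (\<Sum>j\<in>?N i. w i j * z j)) / (1 + (\<Sum>j\<in>?N i. w i j))"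
      using i W[of i] by (auto simp: u_Suc T_def intro!: tendsto_intros z)
    moreover have "(\<lambda>n. u (Suc n) i) \<longlonglongrightarrow> z i" by (rule LIMSEQ_Suc[OF z])
    ultimately show "z i = (s i + (\<Sum>j\<in>?N i. w i j * z j)) / (1 + (\<Sum>j\<in>?N i. w i j))"
      by (rule LIMSEQ_unique[rotated])
  qed
  then show ?thesis by (rule exI[where x = z])
qed

end

(* Clearing the denominator, the equilibrium equation at i says that z i - s i is the total flow
   w i j * (z j - z i) along the edges at i. Summed over all i, the flows along the two
   orientations of each edge cancel. *)
theory Submission
  imports Defs
begin

text \<open>Swapping coordinates is a bijection of the symmetric relation \<open>E\<close> onto
  itself, so the sum equals its own negative. A self-loop needs no separate case: there
  \<open>anti\<close> forces \<open>f i i = 0\<close>.\<close>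

lemma sum_antisymmetric_over_sym_eq_0:
  fixes f :: "'a \<Rightarrow> 'a \<Rightarrow> real"
  assumes "sym E" and anti: "\<And>i j. (i, j) \<in> E \<Longrightarrow> f j i = - f i j"
  shows "(\<Sum>(i, j)\<in>E. f i j) = 0"
proof -
  have "(\<Sum>(i, j)\<in>E. f i j) = (\<Sum>(i, j)\<in>E. f j i)"
    by (rule sum.reindex_bij_witness[where i = prod.swap and j = prod.swap])
      (use \<open>sym E\<close> in \<open>auto dest: symD\<close>)
  also have "\<dots> = - (\<Sum>(i, j)\<in>E. f i j)"
    unfolding sum_negf[symmetric] by (intro sum.cong) (auto simp: anti)
  finally show ?thesis by simp
qed

text \<open>Because \<open>E\<close> lies in \<open>V \<times> V\<close>, grouping the oriented
  edges by their source in \<open>V\<close> misses none. This turns the node-wise balance into a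
  single sum over edges, where cancellation can take place.\<close>

lemma sum_neighbours_eq_sum_edges:
  assumes "undirected_graph V E"
  shows "(\<Sum>i\<in>V. \<Sum>j\<in>neighbours E i. f i j) = (\<Sum>(i, j)\<in>E. f i j)"
proof -
  have "E = Sigma V (neighbours E)"
    using assms by (auto simp: undirected_graph_def neighbours_def)
  then show ?thesis
    using assms finite_neighbours[OF assms] by (simp add: sum.Sigma undirected_graph_def)
qed

lemma equilibrium_opinions_flow:
  assumes w: "\<And>i j. (i, j) \<in> E \<Longrightarrow> w i j \<ge> 0"
    and "equilibrium_opinions V E w s z" and "i \<in> V"
  shows "z i - s i = (\<Sum>j\<in>neighbours E i. w i j * (z j - z i))"
proof -
  \<comment> \<open>Nonnegative weights make the denominator at least 1, so it is nonzero and can be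
    cleared.\<close>
  have "(\<Sum>j\<in>neighbours E i. w i j) \<ge> 0"
    by (intro sum_nonneg) (simp add: neighbours_def w)
  then have "z i * (1 + (\<Sum>j\<in>neighbours E i. w i j)) = s i + (\<Sum>j\<in>neighbours E i. w i j * z j)"
    using assms(2,3) by (simp add: equilibrium_opinions_def eq_divide_eq)
  then show ?thesis
    by (simp add: right_diff_distrib sum_subtractf distrib_left sum_distrib_left mult.commute)
qed

theorem mainTheorem4:
  fixes V :: "'v set" and E :: "('v \<times> 'v) set"
    and w :: "'v \<Rightarrow> 'v \<Rightarrow> real" and s z :: "'v \<Rightarrow> real"
  assumes "undirected_graph V E"
    and "\<And>i j. (i, j) \<in> E \<Longrightarrow> w i j = w j i"
    and "\<And>i j. (i, j) \<in> E \<Longrightarrow> w i j \<ge> 0"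
    and "\<And>i. i \<in> V \<Longrightarrow> s i \<in> {0..1}"
    and "equilibrium_opinions V E w s z"
  shows "overall_opinion V z = (\<Sum>i\<in>V. s i)"
proof -
  have "overall_opinion V z - (\<Sum>i\<in>V. s i) = (\<Sum>i\<in>V. \<Sum>j\<in>neighbours E i. w i j * (z j - z i))"
    unfolding overall_opinion_def sum_subtractf[symmetric]
    by (intro sum.cong refl equilibrium_opinions_flow[OF assms(3,5)])
  also have "\<dots> = (\<Sum>(i, j)\<in>E. w i j * (z j - z i))"
    by (rule sum_neighbours_eq_sum_edges[OF assms(1)])
  also have "\<dots> = 0"
  proof (rule sum_antisymmetric_over_sym_eq_0)
    show "sym E" using assms(1) by (simp add: undirected_graph_def)
    \<comment> \<open>Symmetry of the weights enters here: reversing an edge keeps its weight and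
      flips the sign of the opinion difference.\<close>
    show "w j i * (z i - z j) = - (w i j * (z j - z i))" if "(i, j) \<in> E" for i j
      using assms(2)[OF that] by (simp add: right_diff_distrib)
  qed
  finally show ?thesis by simp
qed

end
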